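(* Let $k > 2$ be an integer. There exists a function $\varepsilon_k:\mathbb{Z}_{>0}\to\mathbb{R}$ with $\varepsilon_k(n) = O(1/n)$ as $n\to\infty$ (the implied constant independent of $r$) such that for all positive integers $n$ and $r$, \[ \mathsf{s}_{kn}(C_n^r) > \frac{kn}{4}\left[1 + \frac{1}{ek} - \varepsilon_k(n)\right]^r . \]
   Context: $C_n = \mathbb{Z}/n\mathbb{Z}$ denotes the cyclic group of order $n$, and $C_n^r$ its $r$-fold direct product; $e$ is Euler's number. For a finite abelian group $G$ with exponent $\exp(G)=n$ (the largest order of an element of $G$) and a positive integer $k$, the generalized Erdős–Ginzburg–Ziv constant $\mathsf{s}_{kn}(G)$ is the smallest integer $m$ such that every sequence (elements may repeat) of $m$ elements of $G$ contains a subsequence of length $kn$ whose terms sum to zero in $G$. Note $\exp(C_n^r)=n$. *)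

theory Defs
  imports "HOL-Algebra.Algebra" "HOL-Library.Landau_Symbols"
begin

definition cyclic_power :: "nat \<Rightarrow> nat \<Rightarrow> (nat \<Rightarrow> int) monoid" where
  "cyclic_power n r = product_group {..<r} (\<lambda>_. integer_mod_group n)"

text \<open>
  HOL-Algebra writes groups multiplicatively, so "sum zero" reads "product \<open>\<one>\<close>".
  A subsequence is given by its set \<open>I\<close> of positions, so repeated terms count
  with multiplicity.
\<close>

definition has_zero_sum_subseq :: "('a, 'b) monoid_scheme \<Rightarrow> nat \<Rightarrow> 'a list \<Rightarrow> bool" where
  "has_zero_sum_subseq G L xs \<longleftrightarrow>
     (\<exists>I \<subseteq> {..<length xs}. card I = L \<and> (\<Otimes>\<^bsub>G\<^esub>i\<in>I. xs ! i) = \<one>\<^bsub>G\<^esub>)"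

text \<open>
  The argument \<open>L\<close> is the subscript \<open>kn\<close> of the generalized Erdos--Ginzburg--Ziv
  constant, where \<open>n\<close> is the exponent of \<open>G\<close>.  The \<open>LEAST\<close> operator would be
  unspecified if no \<open>m\<close> qualified; lemma \<open>egz_constant_exists\<close> shows that some
  \<open>m\<close> does whenever \<open>G\<close> is finite and its exponent divides \<open>L\<close>.
\<close>

definition egz_constant :: "nat \<Rightarrow> ('a, 'b) monoid_scheme \<Rightarrow> nat" where
  "egz_constant L G =
     (LEAST m. \<forall>xs. set xs \<subseteq> carrier G \<and> length xs = m \<longrightarrow> has_zero_sum_subseq G L xs)"

lemma egz_constant_exists:
  assumes "comm_group G" and fin: "finite (carrier G)"
    and exp_dvd: "\<And>a. a \<in> carrier G \<Longrightarrow> a [^]\<^bsub>G\<^esub> L = \<one>\<^bsub>G\<^esub>"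
  shows "\<exists>m. \<forall>xs. set xs \<subseteq> carrier G \<and> length xs = m \<longrightarrow> has_zero_sum_subseq G L xs"
proof (intro exI allI impI)
  interpret comm_group G by fact
  fix xs
  assume xs: "set xs \<subseteq> carrier G \<and> length xs = Suc (card (carrier G) * L)"
  define P where "P a = {i. i < length xs \<and> xs ! i = a}" for a
  have "\<exists>a\<in>carrier G. L \<le> card (P a)"
  proof (rule ccontr)
    assume "\<not> ?thesis"
    then have less: "card (P a) \<le> L" if "a \<in> carrier G" for a
      using that by (meson nat_le_linear)
    have "{..<length xs} \<subseteq> (\<Union>a\<in>carrier G. P a)"
      using xs by (auto simp: P_def intro!: subsetD[OF _ nth_mem])
    then have "length xs \<le> card (\<Union>a\<in>carrier G. P a)"
      using card_mono[of "\<Union>a\<in>carrier G. P a" "{..<length xs}"] fin by (auto simp: P_def)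
    also have "\<dots> \<le> (\<Sum>a\<in>carrier G. card (P a))"
      using fin by (rule card_UN_le)
    also have "\<dots> \<le> card (carrier G) * L"
      using sum_bounded_above[of "carrier G" "\<lambda>a. card (P a)" L] less by simp
    finally show False using xs by simp
  qed
  then obtain a I where a: "a \<in> carrier G" and I: "I \<subseteq> P a" "card I = L"
    by (meson obtain_subset_with_card_n)
  have "(\<Otimes>\<^bsub>G\<^esub>i\<in>I. xs ! i) = (\<Otimes>\<^bsub>G\<^esub>i\<in>I. a)"
    using a I by (intro finprod_cong') (auto simp: P_def)
  also have "\<dots> = \<one>\<^bsub>G\<^esub>"
    using a I exp_dvd by (simp add: finprod_const)
  finally show "has_zero_sum_subseq G L xs"
    using I by (auto simp: has_zero_sum_subseq_def P_def)
qed

lemma comm_group_cyclic_power: "comm_group (cyclic_power n r)"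
proof -
  interpret group "cyclic_power n r"
    by (simp add: cyclic_power_def)
  show ?thesis
    by (rule group_comm_groupI) (auto simp: cyclic_power_def add.commute)
qed

lemma finite_cyclic_power: "n > 0 \<Longrightarrow> finite (carrier (cyclic_power n r))"
  by (auto simp: cyclic_power_def carrier_integer_mod_group intro!: finite_PiE)

lemma pow_cyclic_power:
  assumes "a \<in> carrier (cyclic_power n r)"
  shows "a [^]\<^bsub>cyclic_power n r\<^esub> m = (\<lambda>i\<in>{..<r}. (int m * a i) mod int n)"
proof (induction m)
  case 0
  then show ?case by (auto simp: cyclic_power_def fun_eq_iff)
next
  case (Suc m)
  then show ?case
    by (auto simp: cyclic_power_def nat_pow_def restrict_def fun_eq_iff mod_simps algebra_simps)
qed

lemma ex_egz_constant_cyclic_power: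
  assumes "n > 0"
  shows "\<exists>m. \<forall>xs. set xs \<subseteq> carrier (cyclic_power n r) \<and> length xs = m
               \<longrightarrow> has_zero_sum_subseq (cyclic_power n r) (k * n) xs"
proof (rule egz_constant_exists[OF comm_group_cyclic_power finite_cyclic_power[OF assms]])
  fix a assume a: "a \<in> carrier (cyclic_power n r)"
  show "a [^]\<^bsub>cyclic_power n r\<^esub> (k * n) = \<one>\<^bsub>cyclic_power n r\<^esub>"
    by (subst pow_cyclic_power[OF a]) (auto simp: cyclic_power_def fun_eq_iff)
qed

end

theory Submission
  imports Defs
begin

text \<open>
  Union bound. Take \<open>M\<close> random 0-1 vectors whose coordinates are independent and equal to 1 with odds
  \<open>x = 1 / (e k)\<close>, and fix \<open>kn\<close> of them. Their sum vanishes iff in every coordinate the number of ones is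
  \<open>0, n, \<dots>, kn\<close>. By \<open>(kn choose m) \<le> (e k n / m) ^ m\<close>, each of these \<open>k + 1\<close> counts has probability at
  most \<open>(1 + x) powr (-kn)\<close>: this is what the choice of \<open>x\<close> achieves. Hence the expected number of
  zero-sum subsequences is at most \<open>(e M / (kn)) ^ (kn) * ((k + 1) * (1 + x) powr (-kn)) ^ r\<close>.
  Since \<open>e < 4\<close>, it is below 1 for \<open>M \<le> (kn / 4) * ((1 + x) * (k + 1) powr (-1 / (kn))) ^ r\<close>, and
  \<open>(k + 1) powr (-1 / (kn)) = 1 - O(1 / n)\<close>.
\<close>

section \<open>An exponential bound for binomial coefficients\<close>

lemma power_div_fact_le_exp:
  assumes "(x :: real) \<ge> 0"
  shows "x ^ m / fact m \<le> exp x"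
proof -
  have "(\<lambda>n. x ^ n / fact n) sums exp x"
    using exp_converges[of x] by (simp add: field_simps)
  from sum_le_suminf[OF sums_summable[OF this], of "{m}"] sums_unique[OF this]
  show ?thesis using assms by simp
qed

text \<open>Combines \<open>N choose m <= N ^ m / m!\<close> with the weak Stirling bound
  \<open>m! >= (m / e) ^ m\<close>, which comes from a single term of the series for
  \<open>exp m\<close>. For \<open>m = 0\<close> both sides are 1, whatever the value of the
  quotient.\<close>

lemma binomial_le_exp_power:
  "real (N choose m) \<le> (exp 1 * real N / real m) ^ m"
proof (cases "m = 0")
  case False
  have "real (N choose m) * fact m \<le> real N ^ m"
    using binomial_fact_pow[of N m] by (metis of_nat_fact of_nat_le_iff of_nat_mult of_nat_power)
  moreover have "real m ^ m \<le> exp 1 ^ m * fact m"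
    using power_div_fact_le_exp[of "real m" m] by (simp add: field_simps exp_of_nat_mult[of m 1, simplified])
  ultimately have "(real (N choose m) * fact m) * real m ^ m \<le> real N ^ m * (exp 1 ^ m * fact m)"
    by (intro mult_mono) auto
  then show ?thesis
    using False by (simp add: field_simps power_mult_distrib)
qed simp

section \<open>Weighted counting of subsets\<close>

lemma sum_Pow_power_card:
  fixes x :: "'a :: comm_semiring_1"
  assumes "finite A"
  shows "(\<Sum>S\<in>Pow A. x ^ card S) = (1 + x) ^ card A"
  using prod_add[OF assms, of "\<lambda>_. x" "\<lambda>_. 1"] by (simp add: add.commute)

text \<open>\<open>S\<close> corresponds to the pair of \<open>S \<inter> I\<close> and
  \<open>S - I\<close>, and its weight is the product of theirs. As \<open>P\<close> sees only the
  first part, the second one ranges freely over the subsets of \<open>V - I\<close>. The weights are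
  unnormalised probabilities: each element is chosen independently with odds
  \<open>x\<close>.\<close>

lemma sum_power_card_split:
  fixes x :: real
  assumes "finite V" "I \<subseteq> V"
  shows "(\<Sum>S | S \<subseteq> V \<and> P (S \<inter> I). x ^ card S)
           = (\<Sum>T | T \<subseteq> I \<and> P T. x ^ card T) * (1 + x) ^ (card V - card I)"
proof -
  have fin: "finite I" using assms finite_subset by blast
  have "(\<Sum>T | T \<subseteq> I \<and> P T. x ^ card T) * (1 + x) ^ (card V - card I)
      = (\<Sum>T | T \<subseteq> I \<and> P T. x ^ card T) * (\<Sum>U\<in>Pow (V - I). x ^ card U)"
    using assms fin by (simp add: sum_Pow_power_card card_Diff_subset)
  also have "\<dots> = (\<Sum>(T, U)\<in>{T. T \<subseteq> I \<and> P T} \<times> Pow (V - I). x ^ card T * x ^ card U)"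
    by (simp add: sum_product sum.cartesian_product)
  also have "\<dots> = (\<Sum>S | S \<subseteq> V \<and> P (S \<inter> I). x ^ card S)"
  proof (rule sum.reindex_bij_witness[where j = "\<lambda>(T, U). T \<union> U" and i = "\<lambda>S. (S \<inter> I, S - I)"])
    fix a assume a: "a \<in> {T. T \<subseteq> I \<and> P T} \<times> Pow (V - I)"
    then obtain T U where TU: "a = (T, U)" "T \<subseteq> I" "P T" "U \<subseteq> V - I" by auto
    then have eq: "(T \<union> U) \<inter> I = T" "(T \<union> U) - I = U" by auto
    then show "(case case a of (T, U) \<Rightarrow> T \<union> U of S \<Rightarrow> (S \<inter> I, S - I)) = a"
      by (simp add: TU)
    show "(case a of (T, U) \<Rightarrow> T \<union> U) \<in> {S. S \<subseteq> V \<and> P (S \<inter> I)}"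
      using TU eq assms by auto
    have "card (T \<union> U) = card T + card U"
      using TU assms fin finite_subset by (intro card_Un_disjoint) (blast intro: finite_subset)+
    then show "x ^ card (case a of (T, U) \<Rightarrow> T \<union> U) = (case a of (T, U) \<Rightarrow> x ^ card T * x ^ card U)"
      by (simp add: TU power_add)
  qed (use assms in auto)
  finally show ?thesis by simp
qed

text \<open>Grouped by size, the sets \<open>T\<close> of each admissible size have total weight at
  most 1, and the only such sizes are the \<open>k + 1\<close> multiples of \<open>n\<close> up to
  \<open>k * n\<close>.\<close>

lemma sum_power_card_dvd_le:
  assumes "card I = k * n" "k > 0" "n > 0"
  shows "(\<Sum>T | T \<subseteq> I \<and> n dvd card T. (1 / (exp 1 * real k)) ^ card T) \<le> real (k + 1)"
proof -
  define x where "x = 1 / (exp 1 * real k)"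
  define D where "D = {m. m \<le> k * n \<and> n dvd m}"
  have fin: "finite I" using assms by (auto intro: card_ge_0_finite)
  have finD: "finite D" by (simp add: D_def)
  have "(\<Sum>T | T \<subseteq> I \<and> n dvd card T. x ^ card T)
      = (\<Sum>m\<in>D. \<Sum>T\<in>{T \<in> {T. T \<subseteq> I \<and> n dvd card T}. card T = m}. x ^ card T)"
    using fin finD assms
    by (intro sum.group[symmetric]) (auto simp: D_def dest: card_mono[OF fin])
  also have "\<dots> = (\<Sum>m\<in>D. real (k * n choose m) * x ^ m)"
  proof (rule sum.cong)
    fix m assume "m \<in> D"
    then have "{T \<in> {T. T \<subseteq> I \<and> n dvd card T}. card T = m} = {T. T \<subseteq> I \<and> card T = m}"
      by (auto simp: D_def)
    then show "(\<Sum>T\<in>{T \<in> {T. T \<subseteq> I \<and> n dvd card T}. card T = m}. x ^ card T)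
        = real (k * n choose m) * x ^ m"
      using n_subsets[OF fin, of m] assms by simp
  qed simp
  also have "\<dots> \<le> (\<Sum>m\<in>D. 1)"
  proof (rule sum_mono)
    fix m assume m: "m \<in> D"
    show "real (k * n choose m) * x ^ m \<le> 1"
    proof (cases "m = 0")
      case False
      have "real (k * n choose m) * x ^ m \<le> (exp 1 * real (k * n) / real m) ^ m * x ^ m"
        by (intro mult_right_mono binomial_le_exp_power) (simp add: x_def)
      \<comment> \<open>The choice of \<open>x\<close> cancels \<open>exp 1 * k\<close>. A nonzero
        multiple \<open>m\<close> of \<open>n\<close> is at least \<open>n\<close>, so the remaining
        quotient is at most 1.\<close>
      also have "\<dots> = (real n / real m) ^ m"
        using assms by (simp add: x_def flip: power_mult_distrib)
      also have "\<dots> \<le> 1"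
        using m False by (intro power_le_one) (auto simp: D_def dvd_imp_le)
      finally show ?thesis .
    qed simp
  qed
  also have "\<dots> = real (card D)" by simp
  also have "D \<subseteq> (\<lambda>j. j * n) ` {..k}"
    using assms by (auto simp: D_def dvd_def mult.commute)
  then have "card D \<le> k + 1"
    using surj_card_le[of "{..k}" D "\<lambda>j. j * n"] by simp
  then have "real (card D) \<le> real (k + 1)" by linarith
  finally show ?thesis by (simp add: x_def)
qed

section \<open>The union bound and the random choice of vectors\<close>

lemma ex_not_in_UN_if_sum_less:
  fixes w :: "'a \<Rightarrow> real"
  assumes "finite \<Omega>" "finite J" "\<And>F. F \<in> \<Omega> \<Longrightarrow> w F \<ge> 0"
    and "\<And>I. I \<in> J \<Longrightarrow> B I \<subseteq> \<Omega>"
    and "(\<Sum>I\<in>J. \<Sum>F\<in>B I. w F) < (\<Sum>F\<in>\<Omega>. w F)"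
  shows "\<exists>F\<in>\<Omega>. \<forall>I\<in>J. F \<notin> B I"
proof (rule ccontr)
  assume neg: "\<not> ?thesis"
  \<comment> \<open>If the sets \<open>B I\<close> covered \<open>\<Omega>\<close>, each weight
    would be counted at least once on the right.\<close>
  have "(\<Sum>F\<in>\<Omega>. w F) \<le> (\<Sum>F\<in>\<Omega>. \<Sum>I\<in>J. if F \<in> B I then w F else 0)"
  proof (rule sum_mono)
    fix F assume F: "F \<in> \<Omega>"
    with neg obtain I where "I \<in> J" "F \<in> B I" by blast
    then show "w F \<le> (\<Sum>I\<in>J. if F \<in> B I then w F else 0)"
      using member_le_sum[of I J "\<lambda>I. if F \<in> B I then w F else 0"] assms F by auto
  qed
  also have "\<dots> = (\<Sum>I\<in>J. \<Sum>F\<in>\<Omega>. if F \<in> B I then w F else 0)"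
    by (rule sum.swap)
  also have "\<dots> = (\<Sum>I\<in>J. \<Sum>F\<in>B I. w F)"
  proof (rule sum.cong)
    fix I assume "I \<in> J"
    then have "\<Omega> \<inter> B I = B I" using assms by blast
    then show "(\<Sum>F\<in>\<Omega>. if F \<in> B I then w F else 0) = (\<Sum>F\<in>B I. w F)"
      using sum.inter_restrict[OF assms(1), of w "B I"] by simp
  qed simp
  finally show False using assms by simp
qed

text \<open>The set \<open>F c\<close> consists of the positions of the vectors whose coordinate \<open>c\<close> is 1.\<close>

lemma ex_supports_avoiding:
  fixes k n r M :: nat
  defines "x \<equiv> 1 / (exp 1 * real k)"
  assumes "k > 0" "n > 0" and M: "k * n \<le> M"
    and less: "real (M choose (k * n)) * real (k + 1) ^ r < (1 + x) ^ (k * n * r)"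
  shows "\<exists>F. (\<forall>c<r. F c \<subseteq> {..<M}) \<and>
           (\<forall>I\<subseteq>{..<M}. card I = k * n \<longrightarrow> (\<exists>c<r. \<not> n dvd card (F c \<inter> I)))"
proof -
  define L where "L = k * n"
  define J where "J = {I. I \<subseteq> {..<M} \<and> card I = L}"
  define \<Omega> where "\<Omega> = PiE {..<r} (\<lambda>_. Pow {..<M})"
  \<comment> \<open>The bad event for \<open>I\<close>: the chosen vectors sum to zero in every
    coordinate.\<close>
  define B where "B I = PiE {..<r} (\<lambda>_. {S. S \<subseteq> {..<M} \<and> n dvd card (S \<inter> I)})" for I
  define w where "w F = (\<Prod>c<r. x ^ card (F c))" for F :: "nat \<Rightarrow> nat set"
  have x: "x \<ge> 0" by (simp add: x_def)
  have finJ: "finite J" by (simp add: J_def)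
  have "(\<Sum>F\<in>B I. w F) \<le> (real (k + 1) * (1 + x) ^ (M - L)) ^ r" if I: "I \<in> J" for I
  proof -
    \<comment> \<open>Coordinates are independent, so the sum factors into \<open>r\<close> equal
      sums.\<close>
    have "(\<Sum>F\<in>B I. w F) = (\<Sum>S | S \<subseteq> {..<M} \<and> n dvd card (S \<inter> I). x ^ card S) ^ r"
      unfolding B_def w_def by (subst prod_sum_PiE[symmetric]) auto
    also have "(\<Sum>S | S \<subseteq> {..<M} \<and> n dvd card (S \<inter> I). x ^ card S)
        = (\<Sum>T | T \<subseteq> I \<and> n dvd card T. x ^ card T) * (1 + x) ^ (M - L)"
      using I sum_power_card_split[where V = "{..<M}" and I = I and P = "\<lambda>T. n dvd card T" and x = x] by (simp add: J_def)
    also have "\<dots> ^ r \<le> (real (k + 1) * (1 + x) ^ (M - L)) ^ r"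
      using I assms sum_power_card_dvd_le[of I k n] x
      by (intro power_mono mult_right_mono mult_nonneg_nonneg sum_nonneg)
        (auto simp: J_def L_def x_def)
    finally show ?thesis .
  qed
  then have "(\<Sum>I\<in>J. \<Sum>F\<in>B I. w F) \<le> real (card J) * (real (k + 1) * (1 + x) ^ (M - L)) ^ r"
    by (rule sum_bounded_above)
  also have "\<dots> = (real (M choose L) * real (k + 1) ^ r) * (1 + x) ^ ((M - L) * r)"
    by (simp add: J_def n_subsets power_mult_distrib power_mult)
  also have "\<dots> < (1 + x) ^ (L * r) * (1 + x) ^ ((M - L) * r)"
    using less x by (intro mult_strict_right_mono) (auto simp: L_def)
  \<comment> \<open>By \<open>k * n <= M\<close> the subtraction is not truncated, and the exponents
    add up to that of the total weight of \<open>\<Omega>\<close>.\<close>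
  also have "\<dots> = ((1 + x) ^ M) ^ r"
    using M by (simp add: L_def flip: power_add power_mult add_mult_distrib)
  also have "\<dots> = (\<Sum>F\<in>\<Omega>. w F)"
    unfolding \<Omega>_def w_def by (subst prod_sum_PiE[symmetric]) (auto simp: sum_Pow_power_card)
  finally have "\<exists>F\<in>\<Omega>. \<forall>I\<in>J. F \<notin> B I"
    using x finJ
    by (intro ex_not_in_UN_if_sum_less[where w = w])
      (auto simp: \<Omega>_def B_def w_def finite_PiE intro!: prod_nonneg)
  then obtain F where F: "F \<in> \<Omega>" "\<And>I. I \<in> J \<Longrightarrow> F \<notin> B I" by blast
  show ?thesis
  proof (rule exI[of _ F], intro conjI allI impI)
    fix c assume "c < r"
    then show "F c \<subseteq> {..<M}" using F(1) by (auto simp: \<Omega>_def)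
  next
    fix I assume "I \<subseteq> {..<M}" "card I = k * n"
    then have "F \<notin> B I" using F(2) by (simp add: J_def L_def)
    \<comment> \<open>Since \<open>F\<close> lies in \<open>\<Omega>\<close>, only divisibility can
      fail.\<close>
    then show "\<exists>c<r. \<not> n dvd card (F c \<inter> I)"
      using F(1) by (auto simp: B_def \<Omega>_def PiE_iff)
  qed
qed

section \<open>From set systems to sequences in the group\<close>

lemma finprod_cyclic_power:
  assumes "finite I" "\<And>i. i \<in> I \<Longrightarrow> f i \<in> carrier (cyclic_power n r)"
  shows "(\<Otimes>\<^bsub>cyclic_power n r\<^esub>i\<in>I. f i) = (\<lambda>c\<in>{..<r}. (\<Sum>i\<in>I. f i c) mod int n)"
  using assms
proof (induction I rule: finite_induct)
  case empty
  interpret comm_group "cyclic_power n r" by (rule comm_group_cyclic_power)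
  have "\<one>\<^bsub>cyclic_power n r\<^esub> = (\<lambda>c\<in>{..<r}. 0)" by (simp add: cyclic_power_def)
  then show ?case by simp
next
  case (insert i I)
  interpret comm_group "cyclic_power n r" by (rule comm_group_cyclic_power)
  have "(\<Otimes>\<^bsub>cyclic_power n r\<^esub>i\<in>insert i I. f i)
      = f i \<otimes>\<^bsub>cyclic_power n r\<^esub> (\<lambda>c\<in>{..<r}. (\<Sum>i\<in>I. f i c) mod int n)"
    using insert.hyps insert.prems by (subst insert.IH[symmetric]) (auto intro!: finprod_insert)
  also have "\<dots> = (\<lambda>c\<in>{..<r}. (\<Sum>i\<in>insert i I. f i c) mod int n)"
    using insert.hyps by (auto simp: cyclic_power_def fun_eq_iff mod_simps)
  finally show ?case .
qed

text \<open>The constant \<open>m\<close> is defined through sequences of length exactly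
  \<open>m\<close>. A longer sequence is treated by its first \<open>m\<close> terms, whose
  positions are also positions in the whole.\<close>

lemma less_egz_constant:
  assumes "n > 0" "set xs \<subseteq> carrier (cyclic_power n r)"
    and "\<not> has_zero_sum_subseq (cyclic_power n r) (k * n) xs"
  shows "length xs < egz_constant (k * n) (cyclic_power n r)"
proof (rule ccontr)
  define m where "m = egz_constant (k * n) (cyclic_power n r)"
  assume "\<not> ?thesis"
  then have le: "m \<le> length xs" by (simp add: m_def)
  have "\<forall>ys. set ys \<subseteq> carrier (cyclic_power n r) \<and> length ys = m
            \<longrightarrow> has_zero_sum_subseq (cyclic_power n r) (k * n) ys"
    unfolding m_def egz_constant_def by (rule LeastI_ex[OF ex_egz_constant_cyclic_power[OF assms(1)]])
  moreover have "set (take m xs) \<subseteq> carrier (cyclic_power n r)"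
    using assms(2) by (meson set_take_subset subset_trans)
  ultimately have "has_zero_sum_subseq (cyclic_power n r) (k * n) (take m xs)"
    using le by simp
  then obtain I where I: "I \<subseteq> {..<m}" "card I = k * n"
      "(\<Otimes>\<^bsub>cyclic_power n r\<^esub>i\<in>I. take m xs ! i) = \<one>\<^bsub>cyclic_power n r\<^esub>"
    using le by (auto simp: has_zero_sum_subseq_def)
  interpret comm_group "cyclic_power n r" by (rule comm_group_cyclic_power)
  have "(\<Otimes>\<^bsub>cyclic_power n r\<^esub>i\<in>I. xs ! i) = (\<Otimes>\<^bsub>cyclic_power n r\<^esub>i\<in>I. take m xs ! i)"
    using I(1) le assms(2) by (intro finprod_cong') (auto intro!: subsetD[OF assms(2)])
  with I le have "has_zero_sum_subseq (cyclic_power n r) (k * n) xs"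
    by (auto simp: has_zero_sum_subseq_def intro!: exI[of _ I])
  with assms(3) show False by contradiction
qed

lemma less_egz_constant_if_binomial_less:
  fixes k n r M :: nat
  assumes "k > 0" "n > 0"
    and "real (M choose (k * n)) * real (k + 1) ^ r < (1 + 1 / (exp 1 * real k)) ^ (k * n * r)"
  shows "M < egz_constant (k * n) (cyclic_power n r)"
proof (cases "k * n \<le> M")
  \<comment> \<open>With fewer than \<open>k * n\<close> terms there is no set of
    \<open>k * n\<close> positions, so any sequence serves.\<close>
  case False
  interpret comm_group "cyclic_power n r" by (rule comm_group_cyclic_power)
  define xs where "xs = replicate M \<one>\<^bsub>cyclic_power n r\<^esub>"
  have "set xs \<subseteq> carrier (cyclic_power n r)"
    by (auto simp: xs_def)
  moreover have "\<not> has_zero_sum_subseq (cyclic_power n r) (k * n) xs"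
  proof
    assume "has_zero_sum_subseq (cyclic_power n r) (k * n) xs"
    then obtain I where "I \<subseteq> {..<M}" "card I = k * n"
      by (auto simp: has_zero_sum_subseq_def xs_def)
    with False show False using card_mono[of "{..<M}" I] by simp
  qed
  ultimately have "length xs < egz_constant (k * n) (cyclic_power n r)"
    by (rule less_egz_constant[OF assms(2)])
  then show ?thesis by (simp add: xs_def)
next
  case True
  from ex_supports_avoiding[OF assms(1,2) True assms(3)]
  obtain F where F: "\<And>c. c < r \<Longrightarrow> F c \<subseteq> {..<M}"
    "\<And>I. I \<subseteq> {..<M} \<Longrightarrow> card I = k * n \<Longrightarrow> \<exists>c<r. \<not> n dvd card (F c \<inter> I)" by blast
  \<comment> \<open>The entry 1 is reduced because for \<open>n = 1\<close> the only residue is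
    0.\<close>
  define v where "v i = (\<lambda>c\<in>{..<r}. if i \<in> F c then 1 mod int n else 0)" for i
  have v: "v i \<in> carrier (cyclic_power n r)" for i
    using assms by (auto simp: v_def cyclic_power_def carrier_integer_mod_group)
  define xs where "xs = map v [0..<M]"
  have "\<not> has_zero_sum_subseq (cyclic_power n r) (k * n) xs"
  proof
    assume "has_zero_sum_subseq (cyclic_power n r) (k * n) xs"
    then obtain I where I: "I \<subseteq> {..<M}" "card I = k * n"
      and one: "(\<Otimes>\<^bsub>cyclic_power n r\<^esub>i\<in>I. xs ! i) = \<one>\<^bsub>cyclic_power n r\<^esub>"
      by (auto simp: has_zero_sum_subseq_def xs_def)
    have fin: "finite I" using I(1) finite_subset by blast
    have nth: "xs ! i = v i" if "i \<in> I" for i using that I(1) by (auto simp: xs_def)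
    \<comment> \<open>In this coordinate the sum over \<open>I\<close> counts the ones, and their
      number is not divisible by \<open>n\<close>.\<close>
    obtain c where c: "c < r" "\<not> n dvd card (F c \<inter> I)" using F(2)[OF I] by blast
    have "0 = \<one>\<^bsub>cyclic_power n r\<^esub> c" using c by (simp add: cyclic_power_def)
    also have "\<dots> = (\<Sum>i\<in>I. (xs ! i) c) mod int n"
      using finprod_cyclic_power[OF fin, of "\<lambda>i. xs ! i" n r] c one v by (simp add: nth)
    also have "(\<Sum>i\<in>I. (xs ! i) c) = (\<Sum>i\<in>I. (if i \<in> F c then 1 else 0) mod int n)"
      using c by (intro sum.cong) (auto simp: nth v_def)
    also have "\<dots> mod int n = (\<Sum>i\<in>I. if i \<in> F c then 1 else 0) mod int n"
      by (rule mod_sum_eq)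
    also have "(\<Sum>i\<in>I. if i \<in> F c then 1 else 0) = int (card (F c \<inter> I))"
      using fin by (simp add: sum.If_cases Int_commute)
    finally show False using c by (simp add: mod_eq_0_iff_dvd)
  qed
  with less_egz_constant[OF assms(2), of xs r k] v show ?thesis by (auto simp: xs_def)
qed

section \<open>Choice of the length \<open>M\<close> and size of the error term\<close>

theorem theorem2:
  fixes k :: nat
  assumes "k > 2"
  shows "\<exists>\<epsilon> :: nat \<Rightarrow> real.
           \<epsilon> \<in> O(\<lambda>n. 1 / real n) \<and>
           (\<forall>n r :: nat. n > 0 \<longrightarrow> r > 0 \<longrightarrow>
              real (egz_constant (k * n) (cyclic_power n r))
                > real (k * n) / 4 * (1 + 1 / (exp 1 * real k) - \<epsilon> n) ^ r)"
proof -
  define x where "x = 1 / (exp 1 * real k)"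
  \<comment> \<open>The \<open>(k * n)\<close>-th root of \<open>1 / (k + 1)\<close>: it absorbs the
    factor \<open>(k + 1) ^ r\<close> of the union bound. Then \<open>\<epsilon>\<close> is chosen
    to make \<open>1 + x - \<epsilon> n = (1 + x) * q n\<close>.\<close>
  define q where "q n = real (k + 1) powr (- 1 / real (k * n))" for n
  define \<epsilon> where "\<epsilon> n = (1 + x) * (1 - q n)" for n
  have k: "k > 0" using assms by simp
  have x: "x > 0" using k by (simp add: x_def)
  have "\<epsilon> \<in> O(\<lambda>n. 1 / real n)"
  proof (rule bigoI)
    show "\<forall>\<^sub>F n in sequentially. norm (\<epsilon> n) \<le> ((1 + x) * (ln (real (k + 1)) / real k)) * norm (1 / real n)"
    \<comment> \<open>The bound includes \<open>n = 0\<close>, where division by zero gives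
      \<open>q 0 = 1\<close>.\<close>
    proof (rule always_eventually, rule allI)
      fix n
      have q: "q n = exp (- (ln (real (k + 1)) / real (k * n)))"
        by (simp add: q_def powr_def)
      have "q n \<le> 1"
        by (simp add: q)
      moreover have "1 - q n \<le> ln (real (k + 1)) / real (k * n)"
        using exp_ge_add_one_self[of "- (ln (real (k + 1)) / real (k * n))"] q by linarith
      ultimately have "\<bar>1 - q n\<bar> \<le> ln (real (k + 1)) / real (k * n)" by simp
      then have "(1 + x) * \<bar>1 - q n\<bar> \<le> (1 + x) * (ln (real (k + 1)) / real (k * n))"
        using x by (intro mult_left_mono) auto
      then show "norm (\<epsilon> n) \<le> ((1 + x) * (ln (real (k + 1)) / real k)) * norm (1 / real n)"
        using x by (simp add: \<epsilon>_def abs_mult)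
    qed
  qed
  moreover have "real (egz_constant (k * n) (cyclic_power n r))
      > real (k * n) / 4 * (1 + x - \<epsilon> n) ^ r" if n: "n > 0" for n r
  proof -
    define L where "L = k * n"
    define b where "b = (1 + x) * q n"
    \<comment> \<open>Rounding down costs nothing: the constant exceeds the integer
      \<open>M\<close>, so it is at least \<open>M + 1\<close>, which exceeds the real
      target.\<close>
    define M where "M = nat \<lfloor>real L / 4 * b ^ r\<rfloor>"
    have L: "L > 0" using n k by (simp add: L_def)
    have b: "b > 0" using x by (simp add: b_def q_def)
    have M: "real M \<le> real L / 4 * b ^ r"
      unfolding M_def using b by (intro of_nat_floor) simp
    have "q n ^ L = real (k + 1) powr (- 1 / real L * real L)"
      by (simp add: q_def L_def powr_realpow[symmetric] powr_powr)
    then have qL: "q n ^ L = 1 / real (k + 1)"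
      using L by (simp add: powr_minus_divide)
    have "real (M choose L) \<le> (exp 1 * real M / real L) ^ L"
      by (rule binomial_le_exp_power)
    also have "exp 1 * real M / real L < b ^ r"
    proof -
      have "exp 1 * real M / real L \<le> exp 1 * (real L / 4 * b ^ r) / real L"
        using M by (intro divide_right_mono mult_left_mono) auto
      also have "\<dots> = exp 1 / 4 * b ^ r" using L by simp
      \<comment> \<open>Since \<open>e <= 3 < 4\<close>, the factor \<open>1 / 4\<close> outweighs
        the \<open>e\<close> of the binomial bound and makes the inequality strict.\<close>
      also have "\<dots> < 1 * b ^ r"
        using b exp_le by (intro mult_strict_right_mono) auto
      finally show ?thesis by simp
    qed
    then have "(exp 1 * real M / real L) ^ L < (b ^ r) ^ L"
      using L by (intro power_strict_mono) auto
    also have "(b ^ r) ^ L = ((1 + x) ^ L * q n ^ L) ^ r"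
      by (simp add: b_def mult.commute flip: power_mult power_mult_distrib)
    also have "\<dots> = (1 + x) ^ (L * r) / real (k + 1) ^ r"
      by (simp add: qL power_divide power_mult)
    finally have "real (M choose L) * real (k + 1) ^ r < (1 + x) ^ (L * r)"
      by (simp add: field_simps)
    then have "M < egz_constant (k * n) (cyclic_power n r)"
      using k n by (intro less_egz_constant_if_binomial_less) (simp_all add: L_def x_def)
    moreover have "real L / 4 * b ^ r < real M + 1"
      unfolding M_def by linarith
    ultimately have "real L / 4 * b ^ r < real (egz_constant (k * n) (cyclic_power n r))"
      by linarith
    moreover have "1 + x - \<epsilon> n = b" by (simp add: \<epsilon>_def b_def algebra_simps)
    ultimately show ?thesis by (simp add: L_def)
  qed
  ultimately show ?thesis unfolding x_def by blast
qed

end
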